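(* Let $n\ge 1$ and let $cit_1\ge cit_2\ge\cdots\ge cit_n\ge 0$ be integers (the citation counts of the $n$ publications of a scientist, in decreasing order), at least one of which is positive. Let $h$, $har$ and $g$ be the Hirsch index, the harmonic index and the Egghe index of this sequence, respectively. Then $$h\le har\le g.$$
   Context: Let $p$ be the number of indices $j\in\{1,\dots,n\}$ with $cit_j\ge 1$ (so $p\ge 1$ and $cit_1,\dots,cit_p\geq 1$). The Hirsch index is $h=\max\{m : cit_m\ge m,\ 1\le m\le p\}$. The Egghe index $g$ is the largest integer $k\in\{1,2,\dots,n\}$ such that $\frac1k\sum_{j=1}^k cit_j\ge k$. The harmonic index is $har=\max\left\{1\le k\le p : \sum_{j=1}^k \frac{1}{cit_j}\le 1\right\}$. *)

theory Defs
  imports Complex_Main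
begin

(* A citation record is a pair (n, cit): only the values cit 1, ..., cit n matter.
   If cit is nonincreasing on {1..n} with some cit j >= 1, each of the three sets whose
   maximum is taken below is finite and contains 1. *)

definition num_cited :: "nat \<Rightarrow> (nat \<Rightarrow> nat) \<Rightarrow> nat" where
  "num_cited n cit = card {j \<in> {1..n}. cit j \<ge> 1}"

definition hirsch_index :: "nat \<Rightarrow> (nat \<Rightarrow> nat) \<Rightarrow> nat" where
  "hirsch_index n cit = Max {m. 1 \<le> m \<and> m \<le> num_cited n cit \<and> cit m \<ge> m}"

definition egghe_index :: "nat \<Rightarrow> (nat \<Rightarrow> nat) \<Rightarrow> nat" where
  "egghe_index n cit = Max {k \<in> {1..n}. (1 / real k) * (\<Sum>j=1..k. real (cit j)) \<ge> real k}"

(* For nonincreasing cit, k <= num_cited n cit makes all denominators positive. *)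
definition harmonic_index :: "nat \<Rightarrow> (nat \<Rightarrow> nat) \<Rightarrow> nat" where
  "harmonic_index n cit =
     Max {k. 1 \<le> k \<and> k \<le> num_cited n cit \<and> (\<Sum>j=1..k. 1 / real (cit j)) \<le> 1}"

end

theory Submission
  imports Defs
begin

text \<open>
  Each of the three indices is the maximum of a finite set of candidates, and these sets are
  nested, so it suffices to compare the defining conditions for one fixed number \<open>k\<close> of papers.

  If \<open>cit k \<ge> k\<close>, then monotonicity makes each of the first \<open>k\<close> reciprocals at most \<open>1 / k\<close>, hence
  their sum at most \<open>1\<close>: a Hirsch candidate is a harmonic candidate.

  If the first \<open>k\<close> reciprocals sum to at most \<open>1\<close>, then the harmonic mean of the first \<open>k\<close>
  citation counts is at least \<open>k\<close>, and the arithmetic mean dominates it: a harmonic candidate is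
  an Egghe candidate. The lemma \<open>sum_ge_square_if_sum_inverse_le_1\<close> proves this comparison.
\<close>

text \<open>
  The convex function \<open>t \<mapsto> 1 / t\<close> lies above its tangent at \<open>t = k\<close>, which after scaling
  reads \<open>x \<ge> 2 * k - k\<^sup>2 / x\<close>; summing these bounds gives the claim without the general inequality
  between the harmonic and the arithmetic mean.
\<close>

lemma sum_ge_square_if_sum_inverse_le_1:
  fixes x :: "'a \<Rightarrow> real"
  assumes pos: "\<And>i. i \<in> A \<Longrightarrow> x i > 0"
    and le: "(\<Sum>i\<in>A. 1 / x i) \<le> 1"
  shows "(real (card A))\<^sup>2 \<le> (\<Sum>i\<in>A. x i)"
proof -
  define k where "k = real (card A)"
  have tangent: "2 * k - k\<^sup>2 * (1 / x i) \<le> x i" if "i \<in> A" for i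
  proof -
    have "0 \<le> (x i - k)\<^sup>2 / x i"
      using pos[OF that] by simp
    also have "\<dots> = x i - (2 * k - k\<^sup>2 * (1 / x i))"
      using pos[OF that] by (simp add: field_simps power2_eq_square)
    finally show ?thesis by simp
  qed
  have "k\<^sup>2 * (\<Sum>i\<in>A. 1 / x i) \<le> k\<^sup>2"
    using mult_left_mono[OF le, of "k\<^sup>2"] by simp
  then have "k\<^sup>2 \<le> 2 * k * k - k\<^sup>2 * (\<Sum>i\<in>A. 1 / x i)"
    by (simp add: power2_eq_square)
  also have "\<dots> = (\<Sum>i\<in>A. 2 * k - k\<^sup>2 * (1 / x i))"
    by (simp add: sum_subtractf sum_distrib_left k_def)
  also have "\<dots> \<le> (\<Sum>i\<in>A. x i)"
    by (rule sum_mono) (rule tangent)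
  finally show ?thesis by (simp add: k_def)
qed

lemma num_cited_le: "num_cited n cit \<le> n"
proof -
  have "num_cited n cit \<le> card {1..n}"
    unfolding num_cited_def by (rule card_mono) auto
  then show ?thesis by simp
qed

text \<open>
  In a nonincreasing record the cited papers form an initial segment: if paper \<open>j\<close> were uncited,
  all cited papers would come before it, leaving fewer than \<open>j\<close> of them.
\<close>

lemma cit_pos_if_le_num_cited:
  assumes mono: "\<And>i j. 1 \<le> i \<Longrightarrow> i \<le> j \<Longrightarrow> j \<le> n \<Longrightarrow> cit j \<le> cit i"
    and j: "1 \<le> j" "j \<le> num_cited n cit"
  shows "cit j \<ge> 1"
proof (rule ccontr)
  assume "\<not> cit j \<ge> 1"
  then have "cit i = 0" if "j \<le> i" "i \<le> n" for i
    using mono[OF j(1) that] by simp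
  then have "{i \<in> {1..n}. cit i \<ge> 1} \<subseteq> {1..<j}"
    by (force simp: not_le[symmetric])
  then have "num_cited n cit \<le> j - 1"
    unfolding num_cited_def using card_mono[of "{1..<j}"] by fastforce
  with j show False by simp
qed

theorem theorem1:
  fixes n :: nat and cit :: "nat \<Rightarrow> nat"
  assumes "n \<ge> 1"
    and "\<And>i j. 1 \<le> i \<Longrightarrow> i \<le> j \<Longrightarrow> j \<le> n \<Longrightarrow> cit j \<le> cit i"
    and "\<exists>j\<in>{1..n}. cit j > 0"
  shows "hirsch_index n cit \<le> harmonic_index n cit \<and> harmonic_index n cit \<le> egghe_index n cit"
proof -
  define H where "H = {m. 1 \<le> m \<and> m \<le> num_cited n cit \<and> cit m \<ge> m}"
  define R where "R = {k. 1 \<le> k \<and> k \<le> num_cited n cit \<and> (\<Sum>j=1..k. 1 / real (cit j)) \<le> 1}"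
  define E where "E = {k \<in> {1..n}. (1 / real k) * (\<Sum>j=1..k. real (cit j)) \<ge> real k}"
  note mono = assms(2)
  note pos = cit_pos_if_le_num_cited[of n cit, OF mono]

  have "{j \<in> {1..n}. cit j \<ge> 1} \<noteq> {}"
    using assms(3) by force
  then have "num_cited n cit \<ge> 1"
    unfolding num_cited_def by (simp add: Suc_le_eq card_gt_0_iff)
  then have "1 \<in> H"
    unfolding H_def using pos[of 1] by simp

  have HR: "H \<subseteq> R"
  proof
    fix m assume "m \<in> H"
    then have m: "1 \<le> m" "m \<le> num_cited n cit" "m \<le> cit m"
      by (auto simp: H_def)
    have "1 / real (cit j) \<le> 1 / real m" if "j \<in> {1..m}" for j
    proof -
      have "cit m \<le> cit j"
        using mono[of j m] that m(2) num_cited_le[of n cit] by simp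
      then show ?thesis
        using m by (intro divide_left_mono) auto
    qed
    then have "(\<Sum>j=1..m. 1 / real (cit j)) \<le> (\<Sum>j=1..m. 1 / real m)"
      by (rule sum_mono)
    also have "\<dots> = 1"
      using m(1) by simp
    finally show "m \<in> R"
      using m by (simp add: R_def)
  qed

  have RE: "R \<subseteq> E"
  proof
    fix k assume "k \<in> R"
    then have k: "1 \<le> k" "k \<le> num_cited n cit" "(\<Sum>j=1..k. 1 / real (cit j)) \<le> 1"
      by (auto simp: R_def)
    have "real (cit j) > 0" if "j \<in> {1..k}" for j
      using pos[of j] that k(2) by force
    from sum_ge_square_if_sum_inverse_le_1[OF this k(3)]
    have "(real k)\<^sup>2 \<le> (\<Sum>j=1..k. real (cit j))"
      by simp
    then have "real k \<le> (1 / real k) * (\<Sum>j=1..k. real (cit j))"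
      using k(1) by (simp add: field_simps power2_eq_square)
    then show "k \<in> E"
      using k num_cited_le[of n cit] by (simp add: E_def)
  qed

  have "finite E"
    by (simp add: E_def)
  moreover from this have "finite R"
    using RE by (rule rev_finite_subset)
  ultimately have "Max H \<le> Max R" "Max R \<le> Max E"
    using HR RE \<open>1 \<in> H\<close> by (auto intro!: Max_mono)
  then show ?thesis
    by (simp add: hirsch_index_def harmonic_index_def egghe_index_def H_def R_def E_def)
qed

end
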